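(* Let $X$ be a topological space, $T:X\to X$ a continuous map, and $g$ a generator of a compact topological group $G$. Assume that there is a non-empty subset $Y$ of $\mathcal{U}(T)$ such that $T(Y)\subseteq Y$ and $Y$ (with the subspace topology) is path connected, locally path connected and simply connected. Then $Y\times G\subseteq \mathcal{U}(T\oplus M_g)$, where $M_g:G\to G$, $M_gh=gh$.
   Context: All topological spaces (including topological groups) are assumed Hausdorff. $\mathbb{Z}_+$ is the set of non-negative integers, $\mathbb{T}=\{z\in\mathbb{C}:|z|=1\}$. For a continuous self-map $T$ of a topological space $X$, $\mathcal{U}(T)$ denotes the set of universal elements for $T$, i.e. of those $x\in X$ whose orbit $\{T^nx:n\in\mathbb{Z}_+\}$ is dense in $X$. For maps $T:X\to X$ and $S:Z\to Z$, $T\oplus S:X\times Z\to X\times Z$ is $(T\oplus S)(x,z)=(Tx,Sz)$. An element $g$ of a topological group $G$ is a generator of $G$ if $\{g^n:n\in\mathbb{Z}_+\}$ is dense in $G$. A space $Y$ is path connected if for all $x,y\in Y$ there is a continuous $f:[0,1]\to Y$ with $f(0)=x$, $f(1)=y$; locally path connected if it has a base of topology consisting of path connected sets; simply connected if for every continuous $f:\mathbb{T}\to Y$ there exist a continuous $F:\mathbb{T}\times[0,1]\to Y$ and $x_0\in Y$ with $F(z,0)=f(z)$ and $F(z,1)=x_0$ for all $z\in\mathbb{T}$. *)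

theory Defs
  imports "HOL-Analysis.Analysis"
begin

definition universal_elements :: "('a::topological_space \<Rightarrow> 'a) \<Rightarrow> 'a set" where
  "universal_elements T = {x. closure {(T ^^ n) x |n. True} = UNIV}"

text \<open>
  Topological groups are types of class \<^class>\<open>topological_group_add\<close>.  Despite the additive
  notation, \<^class>\<open>group_add\<close> does not assume commutativity, so \<open>g + h\<close> stands for the product
  \<open>gh\<close>, \<open>0\<close> for the identity and \<open>group_power g n\<close> for \<open>g\<^sup>n\<close>.
\<close>

primrec group_power :: "'g::monoid_add \<Rightarrow> nat \<Rightarrow> 'g" where
  "group_power g 0 = 0"
| "group_power g (Suc n) = g + group_power g n"

definition is_generator :: "'g::topological_group_add \<Rightarrow> bool" where
  "is_generator g \<longleftrightarrow> closure {group_power g n |n. True} = UNIV"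

definition left_mult :: "'g::monoid_add \<Rightarrow> 'g \<Rightarrow> 'g" where
  "left_mult g h = g + h"

text \<open>
  Simple connectedness here means only that every continuous map from the unit circle to \<open>Y\<close> is
  freely homotopic in \<open>Y\<close> to a constant map.  The predicate \<^const>\<open>simply_connected\<close> is not used
  because it requires any two loops to be homotopic and so has path connectedness built in.
\<close>

definition circle_simply_connected :: "'a::topological_space set \<Rightarrow> bool" where
  "circle_simply_connected Y \<longleftrightarrow>
     (\<forall>f :: complex \<Rightarrow> 'a.
        continuous_on (sphere 0 1) f \<and> f ` sphere 0 1 \<subseteq> Y \<longrightarrow>
        (\<exists>(F :: complex \<times> real \<Rightarrow> 'a) x0.
           continuous_on (sphere 0 1 \<times> {0..1}) F \<and> F ` (sphere 0 1 \<times> {0..1}) \<subseteq> Y \<and> x0 \<in> Y \<and>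
           (\<forall>z \<in> sphere 0 1. F (z, 0) = f z \<and> F (z, 1) = x0)))"

text \<open>
  The predicate \<^term>\<open>locally path_connected Y\<close> agrees with the existence of a base of the subspace
  topology consisting of path connected sets.
\<close>

lemma locally_path_connected_iff_base:
  fixes Y :: "'a::topological_space set"
  shows "locally path_connected Y \<longleftrightarrow>
     (\<exists>B. (\<forall>U\<in>B. openin (top_of_set Y) U \<and> path_connected U) \<and>
          (\<forall>W. openin (top_of_set Y) W \<longrightarrow> (\<exists>B'\<subseteq>B. \<Union>B' = W)))"
    (is "_ \<longleftrightarrow> ?R")
proof
  assume L: "locally path_connected Y"
  show ?R
  proof (rule exI[of _ "{U. openin (top_of_set Y) U \<and> path_connected U}"], 
      intro conjI allI impI, blast)
    fix W assume W: "openin (top_of_set Y) W"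
    let ?B = "{U. openin (top_of_set Y) U \<and> path_connected U \<and> U \<subseteq> W}"
    have "W \<subseteq> \<Union>?B"
    proof
      fix x assume "x \<in> W"
      with L W obtain U where "openin (top_of_set Y) U" "path_connected U" "x \<in> U" "U \<subseteq> W"
        unfolding locally_path_connected by meson
      then show "x \<in> \<Union>?B" by blast
    qed
    then have "\<Union>?B = W" by blast
    then show "\<exists>B'\<subseteq>{U. openin (top_of_set Y) U \<and> path_connected U}. \<Union>B' = W"
      by (intro exI[of _ ?B]) auto
  qed
next
  assume ?R
  then obtain B where B: "\<And>U. U \<in> B \<Longrightarrow> openin (top_of_set Y) U \<and> path_connected U"
    and U: "\<And>W. openin (top_of_set Y) W \<Longrightarrow> \<exists>B'\<subseteq>B. \<Union>B' = W"
    by metis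
  show "locally path_connected Y"
    unfolding locally_path_connected
  proof (intro allI impI)
    fix W x assume "openin (top_of_set Y) W \<and> x \<in> W"
    then obtain V where "V \<in> B" "x \<in> V" "V \<subseteq> W"
      using U[of W] by blast
    then show "\<exists>u. openin (top_of_set Y) u \<and> path_connected u \<and> x \<in> u \<and> u \<subseteq> W"
      using B by blast
  qed
qed

end

(*
  For x in Y let O be the orbit closure of (x, 1) under the skew map, and H the set of h with (x, h)
  in O.  H is a closed subsemigroup, hence a closed subgroup, of G, and everything follows once
  H = G.  Otherwise the fibres of O over Y are cosets of H, and this gives a continuous map from Y
  to G/H that sends T y to g times the image of y.  A nontrivial character of G/H would turn it into
  a map q from Y to the circle with q (T y) = z q y, z not 1, whose continuous logarithm drifts
  monotonically along orbits, against recurrence.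

  No character theory is needed: it is enough to have a continuous H-invariant p on G without zeros
  such that p (g h) / p h is never a positive real.  For an almost period M of g (that is, g^M
  close to 1) take p h = sum over n < M of f (g^n h) w^n, with w^M = 1 and f continuous, H-invariant
  and not constant; w is chosen by finite Fourier analysis on Z/M.
*)
theory Submission
  imports Defs
begin

section \<open>Compact monothetic groups\<close>

lemma group_power_add: "group_power g (m + n) = group_power g m + group_power g n"
  by (induction m) (simp_all add: add.assoc)

lemma group_power_commute: "group_power g m + group_power g n = group_power g n + group_power g m"
  by (metis add.commute group_power_add)

lemma generator_closed_all:
  assumes "is_generator g" "closed {x. P x}" "\<And>n. P (group_power g n)"
  shows "P x"
proof -
  have "closure {group_power g n |n. True} \<subseteq> {x. P x}"
    by (rule closure_minimal) (use assms in auto)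
  with assms(1) show ?thesis by (auto simp: is_generator_def)
qed

text \<open>Powers of \<open>g\<close> commute with each other, and commuting is a closed condition
  in a Hausdorff group; density extends it to one variable at a time.\<close>

lemma generator_commute:
  fixes g :: "'g::{topological_group_add, t2_space}"
  assumes g: "is_generator g"
  shows "x + y = y + (x::'g)"
proof (rule generator_closed_all[OF g, where P="\<lambda>y. x + y = y + x"])
  show "closed {y. x + y = y + x}" by (intro closed_Collect_eq continuous_intros)
  show "x + group_power g n = group_power g n + x" for n
  proof (rule generator_closed_all[OF g, where P="\<lambda>x. x + group_power g n = group_power g n + x"])
    show "closed {x. x + group_power g n = group_power g n + x}"
      by (intro closed_Collect_eq continuous_intros)
  qed (rule group_power_commute)
qed

text \<open>By density the translates of \<open>V\<close> by powers of \<open>g\<close> cover the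
  group, and compactness leaves finitely many of them, so the exponents stay bounded.\<close>

lemma generator_syndetic:
  fixes g :: "'g::{topological_group_add, t2_space}"
  assumes K: "compact (UNIV::'g set)" and g: "is_generator g" and V: "open V" "0 \<in> V"
  obtains N where "\<And>x. \<exists>s\<le>N. x - group_power g s \<in> V"
proof -
  define U where "U s = (\<lambda>x. x - group_power g s) -` V" for s
  have U: "open (U s)" for s
    unfolding U_def by (intro open_vimage V continuous_intros)
  have "x \<in> \<Union>(range U)" for x
  proof -
    have "open ((\<lambda>y. x - y) -` V)" by (intro open_vimage V continuous_intros)
    moreover have "x \<in> closure {group_power g n |n. True}" using g by (auto simp: is_generator_def)
    moreover have "x \<in> (\<lambda>y. x - y) -` V" using V by simp
    ultimately obtain n where "group_power g n \<in> (\<lambda>y. x - y) -` V"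
      unfolding closure_iff_nhds_not_empty by blast
    then show ?thesis by (auto simp: U_def)
  qed
  then have "UNIV \<subseteq> (\<Union>s\<in>UNIV. U s)" by auto
  then obtain D where D: "finite D" "UNIV \<subseteq> (\<Union>s\<in>D. U s)"
    using compactE_image[OF K, of UNIV U] U by metis
  show thesis
  proof
    fix x
    obtain s where "s \<in> D" "x \<in> U s" using D by blast
    then show "\<exists>s\<le>Max D. x - group_power g s \<in> V" using D(1) by (auto simp: U_def intro!: exI[of _ s])
  qed
qed

text \<open>Pigeonhole: finitely many sets that are small relative to \<open>V\<close> cover the
  group, so two powers of \<open>h\<close> fall into the same one, and their quotient is a power of
  \<open>h\<close> in \<open>V\<close>.\<close>

lemma compact_group_recurrent:
  fixes h :: "'g::topological_group_add"
  assumes K: "compact (UNIV::'g set)" and V: "open V" "0 \<in> V"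
  obtains n where "L \<le> n" "group_power h n \<in> V"
proof -
  define D where "D = (\<lambda>(a,b). - a + b) -` V"
  have "open D" unfolding D_def case_prod_unfold
    by (intro open_vimage V continuous_intros)
  have "\<exists>N. open N \<and> a \<in> N \<and> N \<times> N \<subseteq> D" for a :: 'g
  proof -
    have "(a, a) \<in> D" using V by (simp add: D_def)
    with \<open>open D\<close> obtain A B where "open A" "open B" "a \<in> A" "a \<in> B" "A \<times> B \<subseteq> D"
      by (metis mem_Sigma_iff open_prod_def)
    then show ?thesis by (intro exI[of _ "A \<inter> B"]) auto
  qed
  then obtain N where N: "\<And>a. open (N a)" "\<And>a. a \<in> N a" "\<And>a. N a \<times> N a \<subseteq> D" by metis
  obtain C where C: "finite C" "UNIV \<subseteq> (\<Union>a\<in>C. N a)"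
    using compactE_image[OF K, of UNIV N] N by (metis UNIV_I UN_I subsetI)
  \<comment> \<open>Distinct multiples of \<open>Suc L\<close> differ by more than \<open>L\<close>,
    which makes the exponent of the quotient at least \<open>L\<close>.\<close>
  let ?x = "\<lambda>i. group_power h (i * Suc L)"
  have "\<exists>a. a \<in> C \<and> ?x i \<in> N a" for i using C(2) by blast
  then obtain c where c: "\<And>i. c i \<in> C" "\<And>i. ?x i \<in> N (c i)" by metis
  have "finite (range c)" using C(1) c(1) by (auto intro: finite_subset)
  then have "\<not> inj c" using finite_imageD by blast
  then obtain i j where ij: "i < j" "c i = c j" by (metis injI linorder_neqE_nat)
  have "(?x i, ?x j) \<in> D" using N(3) c(2) ij by (metis SigmaI subsetD)
  moreover have "j * Suc L = i * Suc L + (j - i) * Suc L"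
    using ij by (metis add_mult_distrib le_add_diff_inverse less_imp_le)
  then have "?x j = ?x i + group_power h ((j - i) * Suc L)"
    by (simp only: group_power_add)
  ultimately have "group_power h ((j - i) * Suc L) \<in> V"
    by (simp only: D_def vimage_eq prod.case minus_add_cancel)
  moreover have "1 * L \<le> (j - i) * Suc L" using ij(1) by (intro mult_le_mono) auto
  then have "L \<le> (j - i) * Suc L" by (simp only: nat_mult_1)
  ultimately show thesis using that by blast
qed

text \<open>Positive powers of \<open>h\<close> come arbitrarily close to the identity; with one
  factor removed they give elements of \<open>H\<close> arbitrarily close to \<open>- h\<close>, and
  \<open>H\<close> is closed.\<close>

lemma closed_subsemigroup_uminus:
  fixes H :: "'g::topological_group_add set"
  assumes K: "compact (UNIV::'g set)" and H: "closed H" "0 \<in> H"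
    and add: "\<And>a b. a \<in> H \<Longrightarrow> b \<in> H \<Longrightarrow> a + b \<in> H" and h: "h \<in> H"
  shows "- h \<in> H"
proof (rule ccontr)
  assume "- h \<notin> H"
  then have "open ((\<lambda>x. - h + x) -` (- H))" "0 \<in> (\<lambda>x. - h + x) -` (- H)"
    using H by (auto intro!: open_vimage continuous_intros)
  then obtain n where n: "1 \<le> n" "group_power h n \<in> (\<lambda>x. - h + x) -` (- H)"
    by (rule compact_group_recurrent[OF K])
  have "group_power h m \<in> H" for m using H(2) h add by (induction m) auto
  moreover obtain m where "n = Suc m" using n(1) by (cases n) auto
  ultimately show False using n(2) by (simp add: add.assoc[symmetric])
qed

section \<open>A rotating trigonometric sum\<close>

text \<open>Orthogonality of the characters of Z/M: the terms are powers of one \<open>M\<close>-th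
  root of unity, so the geometric sum vanishes unless that root is 1.\<close>

lemma sum_cis_multiples:
  fixes k :: int
  assumes M: "M > 0"
  shows "(\<Sum>j<M. cis (2 * pi * real j * of_int k / real M)) = (if int M dvd k then of_nat M else 0)"
proof -
  define z where "z = cis (2 * pi * of_int k / real M)"
  have z: "cis (2 * pi * real j * of_int k / real M) = z ^ j" for j
    by (simp add: z_def Complex.DeMoivre mult_ac)
  have "z ^ M = cis (2 * pi * of_int k)" using M by (simp add: z_def Complex.DeMoivre)
  then have zM: "z ^ M = 1" by (simp add: cis_multiple_2pi)
  have z1: "z = 1 \<longleftrightarrow> int M dvd k"
  proof
    assume "z = 1"
    then have "cos (2 * pi * of_int k / real M) = 1" by (simp add: z_def complex_eq_iff)
    then obtain m :: int where "2 * pi * of_int k / real M = of_int m * 2 * pi"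
      using cos_one_2pi_int by blast
    then have "real_of_int k = of_int (int M * m)" using M by (simp add: field_simps)
    then show "int M dvd k" by (metis dvd_triv_left of_int_eq_iff)
  next
    assume "int M dvd k"
    then obtain m where m: "k = int M * m" by blast
    have "2 * pi * of_int k / real M = 2 * pi * of_int m" using M by (simp add: m)
    then show "z = 1" unfolding z_def by (simp only: cis_multiple_2pi Ints_of_int)
  qed
  show ?thesis
  proof (cases "z = 1")
    case True
    then show ?thesis using z1 by (simp add: z)
  next
    case False
    then show ?thesis using z1 zM by (simp add: z geometric_sum)
  qed
qed

text \<open>
  The trigonometric polynomial with nonnegative coefficients \<open>\<bar>A j\<bar>\<^sup>2\<close> is the Fourier transform of
  \<open>1\<^sub>P * 1\<^sub>-\<^sub>P\<close>, which lives on \<open>P - P\<close>.  Testing \<open>b\<close> against it gives a bound for the Fourier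
  coefficients that depends only on the density of \<open>P\<close>.
\<close>

lemma large_fourier_coefficient:
  fixes b :: "nat \<Rightarrow> complex"
  assumes M: "M > 0" and P: "P \<subseteq> {..<M}"
    and b: "\<And>s t. s \<in> P \<Longrightarrow> t \<in> P \<Longrightarrow> \<eta> \<le> Re (b ((s + M - t) mod M))"
  obtains w where "norm w = 1" "w ^ M = 1" "\<eta> * card P \<le> norm (\<Sum>n<M. b n * w ^ n)"
proof -
  have fP: "finite P" using P finite_subset by blast
  \<comment> \<open>\<open>e j\<close> is a character of Z/M, kept as a function on the integers so
    that differences of indices can be written directly.\<close>
  define e where "e j k = cis (2 * pi * real j * of_int k / real M)" for j :: nat and k :: int
  have e_add: "e j (k + l) = e j k * e j l" for j k l
    by (simp add: e_def cis_mult add_divide_distrib distrib_left)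
  have e_diff: "e j (k - l) = e j k * cnj (e j l)" for j k l
    by (simp add: e_def cis_mult cis_cnj diff_divide_distrib right_diff_distrib)
  have e_sum: "(\<Sum>j<M. e j k) = (if int M dvd k then of_nat M else 0)" for k
    unfolding e_def by (rule sum_cis_multiples[OF M])
  define B where "B j = (\<Sum>n<M. b n * e j (int n))" for j
  define A where "A j = (\<Sum>s\<in>P. e j (int s))" for j
  have A2: "complex_of_real ((norm (A j))\<^sup>2) = (\<Sum>s\<in>P. \<Sum>t\<in>P. e j (int t - int s))" for j
  proof -
    have "complex_of_real ((norm (A j))\<^sup>2) = cnj (A j) * A j"
      by (simp only: complex_norm_square mult.commute)
    also have "\<dots> = (\<Sum>s\<in>P. \<Sum>t\<in>P. e j (int t - int s))"
      unfolding A_def cnj_sum sum_product e_diff by (intro sum.cong refl mult.commute)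
    finally show ?thesis .
  qed
  have "complex_of_real (\<Sum>j<M. (norm (A j))\<^sup>2) = (\<Sum>j<M. \<Sum>s\<in>P. \<Sum>t\<in>P. e j (int t - int s))"
    by (simp only: of_real_sum A2)
  also have "\<dots> = (\<Sum>s\<in>P. \<Sum>j<M. \<Sum>t\<in>P. e j (int t - int s))" by (rule sum.swap)
  also have "\<dots> = (\<Sum>s\<in>P. \<Sum>t\<in>P. \<Sum>j<M. e j (int t - int s))"
    by (intro sum.cong refl sum.swap)
  also have "\<dots> = (\<Sum>s\<in>P. \<Sum>t\<in>P. if t = s then of_nat M else 0)"
  proof (intro sum.cong refl)
    fix s t assume "s \<in> P" "t \<in> P"
    then have "s < M" "t < M" using P by auto
    then have "int M dvd int t - int s \<longleftrightarrow> t = s"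
      using mod_eq_dvd_iff[of "int t" "int M" "int s"] by auto
    then show "(\<Sum>j<M. e j (int t - int s)) = (if t = s then of_nat M else 0)" by (simp add: e_sum)
  qed
  also have "\<dots> = of_nat (card P * M)" using fP by simp
  finally have normA: "(\<Sum>j<M. (norm (A j))\<^sup>2) = real (card P * M)"
    by (metis of_real_eq_iff of_real_of_nat_eq)
  \<comment> \<open>By orthogonality only the values of \<open>b\<close> at differences
    \<open>s - t\<close> in Z/M survive the weighting; adding \<open>M\<close> before subtracting
    avoids truncation.\<close>
  have "(\<Sum>j<M. B j * complex_of_real ((norm (A j))\<^sup>2))
      = (\<Sum>j<M. \<Sum>s\<in>P. \<Sum>t\<in>P. \<Sum>n<M. b n * e j (int n + (int t - int s)))"
    unfolding A2 B_def e_add by (simp add: sum_distrib_left sum_distrib_right mult.assoc)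
  also have "\<dots> = (\<Sum>s\<in>P. \<Sum>j<M. \<Sum>t\<in>P. \<Sum>n<M. b n * e j (int n + (int t - int s)))"
    by (rule sum.swap)
  also have "\<dots> = (\<Sum>s\<in>P. \<Sum>t\<in>P. \<Sum>j<M. \<Sum>n<M. b n * e j (int n + (int t - int s)))"
    by (intro sum.cong refl sum.swap)
  also have "\<dots> = (\<Sum>s\<in>P. \<Sum>t\<in>P. of_nat M * b ((s + M - t) mod M))"
  proof (intro sum.cong refl)
    fix s t assume "s \<in> P" "t \<in> P"
    then have st: "s < M" "t < M" using P by auto
    have iff: "int M dvd int n + (int t - int s) \<longleftrightarrow> n = (s + M - t) mod M" if n: "n < M" for n
    proof -
      have "int M dvd int n + (int t - int s) \<longleftrightarrow> int n mod int M = (int s - int t) mod int M"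
        by (simp add: mod_eq_dvd_iff algebra_simps)
      also have "(int s - int t) mod int M = (int s - int t + int M) mod int M" by simp
      also have "int s - int t + int M = int (s + M - t)" using st by simp
      also have "int n mod int M = int n" using n by simp
      finally show ?thesis by (metis of_nat_eq_iff zmod_int)
    qed
    have "(\<Sum>j<M. \<Sum>n<M. b n * e j (int n + (int t - int s)))
        = (\<Sum>n<M. b n * (\<Sum>j<M. e j (int n + (int t - int s))))"
      unfolding sum_distrib_left by (rule sum.swap)
    also have "\<dots> = (\<Sum>n<M. if n = (s + M - t) mod M then of_nat M * b ((s + M - t) mod M) else 0)"
      by (intro sum.cong refl) (use iff in \<open>auto simp: e_sum\<close>)
    also have "\<dots> = of_nat M * b ((s + M - t) mod M)" using M by simp
    finally show "(\<Sum>j<M. \<Sum>n<M. b n * e j (int n + (int t - int s))) = of_nat M * b ((s + M - t) mod M)" .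
  qed
  finally have BA: "(\<Sum>j<M. B j * complex_of_real ((norm (A j))\<^sup>2))
      = (\<Sum>s\<in>P. \<Sum>t\<in>P. of_nat M * b ((s + M - t) mod M))" .
  define \<beta> where "\<beta> = Max ((\<lambda>j. norm (B j)) ` {..<M})"
  have \<beta>: "norm (B j) \<le> \<beta>" if "j < M" for j using that by (simp add: \<beta>_def)
  have "\<beta> \<in> (\<lambda>j. norm (B j)) ` {..<M}" unfolding \<beta>_def using M by (intro Max_in) auto
  then obtain j where j: "norm (B j) = \<beta>" by auto
  \<comment> \<open>The weighted sum is now bounded below through the values of \<open>b\<close> on
    differences, and above by \<open>\<beta>\<close> times the total weight
    \<open>card P * M\<close>.\<close>
  have "(\<Sum>s\<in>P. \<Sum>t\<in>P. real M * \<eta>) \<le> (\<Sum>s\<in>P. \<Sum>t\<in>P. Re (of_nat M * b ((s + M - t) mod M)))"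
    by (intro sum_mono) (simp add: b mult_left_mono)
  also have "\<dots> = Re (\<Sum>j<M. B j * complex_of_real ((norm (A j))\<^sup>2))" by (simp only: BA Re_sum)
  also have "\<dots> \<le> norm (\<Sum>j<M. B j * complex_of_real ((norm (A j))\<^sup>2))" by (rule complex_Re_le_cmod)
  also have "\<dots> \<le> (\<Sum>j<M. \<beta> * (norm (A j))\<^sup>2)"
    by (rule sum_norm_le) (simp add: norm_mult norm_power \<beta> mult_right_mono)
  also have "\<dots> = \<beta> * (real (card P) * real M)" unfolding sum_distrib_left[symmetric] normA by simp
  finally have le: "(real (card P) * real M) * (\<eta> * card P) \<le> (real (card P) * real M) * \<beta>"
    by (simp add: mult_ac)
  have "\<eta> * card P \<le> \<beta>"
  proof (cases "card P = 0")
    case True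
    then show ?thesis using j by (metis mult_zero_right norm_ge_zero of_nat_0)
  next
    case False
    then show ?thesis using le M by (simp add: mult_le_cancel_left)
  qed
  moreover have "B j = (\<Sum>n<M. b n * e j 1 ^ n)"
    unfolding B_def e_def by (simp add: Complex.DeMoivre mult_ac)
  moreover have "e j 1 ^ M = cis (2 * pi * real j)"
    using M by (simp add: e_def Complex.DeMoivre)
  then have "e j 1 ^ M = 1" by (simp add: cis_multiple_2pi)
  ultimately show thesis using that[of "e j 1"] j by (simp add: e_def)
qed

section \<open>Uniform continuity and suprema of translates on a compact group\<close>

text \<open>A tube argument at \<open>v = 0\<close> for the map sending \<open>(v, x)\<close> to
  \<open>f (v + x)\<close>, whose second factor is compact.\<close>

lemma compact_group_uniformly_continuous:
  fixes f :: "'g::topological_group_add \<Rightarrow> real"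
  assumes K: "compact (UNIV::'g set)" and f: "continuous_on UNIV f" and e: "e > 0"
  obtains V where "open V" "0 \<in> V" "\<And>v x. v \<in> V \<Longrightarrow> \<bar>f (v + x) - f x\<bar> \<le> e"
proof -
  have "continuous_on (UNIV \<times> UNIV) (\<lambda>(v, x). f (v + x))"
    unfolding case_prod_unfold by (intro continuous_on_compose2[OF f] continuous_intros) auto
  from continuous_on_prod_compactE[OF this K UNIV_I e, of 0] obtain V
    where "0 \<in> V" "open V" "\<forall>v\<in>V \<inter> UNIV. \<forall>x\<in>UNIV. dist (f (v + x)) (f (0 + x)) \<le> e" by auto
  then show thesis using that by (auto simp: dist_real_def)
qed

text \<open>A small left shift changes all the right translates of \<open>u\<close> by uniformly
  little, because left and right translations commute; a supremum of such a family is continuous.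
  For a subgroup \<open>H\<close> this produces continuous functions that are constant on its
  cosets.\<close>

lemma continuous_SUP_translates:
  fixes u :: "'g::topological_group_add \<Rightarrow> real"
  assumes K: "compact (UNIV :: 'g set)" and u: "continuous_on UNIV u"
    and bdd: "\<And>x. u x \<le> B" and H: "H \<noteq> {}"
  shows "continuous_on UNIV (\<lambda>x. SUP h\<in>H. u (x + h))"
proof -
  define f where "f x = (SUP h\<in>H. u (x + h))" for x
  have up: "u (x + h) \<le> f x" if "h \<in> H" for x h
    unfolding f_def using that bdd by (intro cSUP_upper) (auto intro!: bdd_aboveI[of _ B])
  have le: "f x \<le> f y + e" if "\<And>h. h \<in> H \<Longrightarrow> u (x + h) \<le> u (y + h) + e" for x y e
    unfolding f_def[of x] by (rule cSUP_least[OF H]) (use that up in \<open>meson add_right_mono order_trans\<close>)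
  have "(f \<longlongrightarrow> f x) (at x)" for x
  proof (rule tendstoI)
    fix e :: real assume "e > 0"
    then obtain V where V: "open V" "0 \<in> V" and Vu: "\<And>v x. v \<in> V \<Longrightarrow> \<bar>u (v + x) - u x\<bar> \<le> e / 2"
      using compact_group_uniformly_continuous[OF K u, of "e / 2"] by (metis half_gt_zero)
    have close: "dist (f y) (f x) < e" if "y - x \<in> V" for y
    proof -
      have "\<bar>u (y + h) - u (x + h)\<bar> \<le> e / 2" for h
        using Vu[OF that, of "x + h"] by (simp add: add.assoc[symmetric])
      then have "u (y + h) \<le> u (x + h) + e / 2" "u (x + h) \<le> u (y + h) + e / 2" for h
        by (smt (verit))+
      then have "f y \<le> f x + e / 2" "f x \<le> f y + e / 2" by (auto intro: le)
      then show ?thesis using \<open>e > 0\<close> by (simp add: dist_real_def abs_less_iff)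
    qed
    have "open ((\<lambda>y. y - x) -` V)" by (intro open_vimage V continuous_intros)
    moreover have "x \<in> (\<lambda>y. y - x) -` V" using V by simp
    ultimately show "\<forall>\<^sub>F y in at x. dist (f y) (f x) < e"
      unfolding eventually_at_topological using close by blast
  qed
  then have "continuous_on UNIV f" by (simp add: continuous_on_def)
  then show ?thesis by (simp add: f_def[abs_def])
qed

text \<open>\<open>p\<close> is a sum of values of \<open>f\<close> along an orbit, twisted by
  powers of \<open>w\<close>. It is almost an eigenfunction: \<open>w * p (g + x)\<close> is close
  to \<open>p x\<close>. The choice of \<open>w\<close> keeps \<open>p (g + x) - p x\<close> away
  from 0 everywhere, which excludes both zeros of \<open>p\<close> and positive ratios. Only left
  translates of \<open>f\<close> enter, so right invariance is inherited.\<close>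

lemma generator_rotating_function:
  fixes g :: "'g::{topological_group_add, t2_space}" and f :: "'g \<Rightarrow> real"
  assumes K: "compact (UNIV::'g set)" and g: "is_generator g"
    and f: "continuous_on UNIV f" and nonconst: "f a \<noteq> f b"
  obtains p :: "'g \<Rightarrow> complex" where "continuous_on UNIV p" "\<And>x. p x \<noteq> 0"
    "\<And>x t. t > 0 \<Longrightarrow> p (g + x) \<noteq> of_real t * p x"
    "\<And>k x. (\<And>y. f (y + k) = f y) \<Longrightarrow> p (x + k) = p x"
proof -
  let ?g = "group_power g"
  note comm = generator_commute[OF g]
  have lcomm: "x + (y + z) = y + (x + z)" for x y z :: 'g
    by (metis add.assoc comm)
  note ac = add.assoc comm lcomm
  define d where "d x = f (g + x) - f x" for x
  have d_cont: "continuous_on UNIV d"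
    unfolding d_def by (intro continuous_intros continuous_on_compose2[OF f]) auto
  have "\<exists>c. d c \<noteq> 0"
  proof (rule ccontr)
    assume "\<nexists>c. d c \<noteq> 0"
    then have "f (?g n) = f 0" for n by (induction n) (simp_all add: d_def)
    moreover have "closed {x. f x = f 0}" by (intro closed_Collect_eq continuous_intros f)
    ultimately have "f x = f 0" for x using generator_closed_all[OF g, of "\<lambda>x. f x = f 0"] by blast
    then show False using nonconst by metis
  qed
  then obtain c where c: "d c \<noteq> 0" by blast
  define \<sigma> where "\<sigma> = sgn (d c)"
  \<comment> \<open>One third of the increment at \<open>c\<close>: it stays above
    \<open>2 * \<eta>\<close> on all of \<open>c + (W - W)\<close>, and above \<open>\<eta>\<close>
    after a further error of \<open>2 * \<epsilon>\<close>.\<close>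
  define \<eta> where "\<eta> = \<bar>d c\<bar> / 3"
  have \<eta>: "\<eta> > 0" and dc: "\<sigma> * d c = 3 * \<eta>" and \<sigma>: "\<bar>\<sigma>\<bar> = 1"
    using c by (auto simp: \<eta>_def \<sigma>_def sgn_real_def)
  have "open ((\<lambda>z. fst z - snd z) -` {x. \<sigma> * d (x + c) > 2 * \<eta>})"
    by (intro open_vimage open_Collect_less continuous_intros continuous_on_compose2[OF d_cont]) auto
  moreover have "(0, 0) \<in> (\<lambda>z. fst z - snd z) -` {x. \<sigma> * d (x + c) > 2 * \<eta>}" using dc \<eta> by simp
  ultimately obtain W1 W2 where W12: "open W1" "open W2" "0 \<in> W1" "0 \<in> W2"
    "W1 \<times> W2 \<subseteq> (\<lambda>z. fst z - snd z) -` {x. \<sigma> * d (x + c) > 2 * \<eta>}"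
    by (elim open_prod_elim) auto
  define W where "W = W1 \<inter> W2"
  have W: "open W" "0 \<in> W" using W12 by (auto simp: W_def)
  have Wd: "\<sigma> * d (x - y + c) > 2 * \<eta>" if "x \<in> W" "y \<in> W" for x y
  proof -
    have "(x, y) \<in> W1 \<times> W2" using that by (simp add: W_def)
    then have "(x, y) \<in> (\<lambda>z. fst z - snd z) -` {x. \<sigma> * d (x + c) > 2 * \<eta>}" using W12(5) by blast
    then show ?thesis by simp
  qed
  obtain N where N: "\<And>x. \<exists>s\<le>N. x - ?g s \<in> W" using generator_syndetic[OF K g W] by blast
  \<comment> \<open>\<open>\<kappa> * M\<close> is the Fourier bound obtained from a proportion
    \<open>1 / Suc N\<close> of the times below \<open>M\<close>.\<close>
  define \<kappa> where "\<kappa> = \<eta> / real (Suc N)"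
  have \<kappa>: "\<kappa> > 0" "\<kappa> \<le> \<eta>" using \<eta> by (auto simp: \<kappa>_def field_simps)
  \<comment> \<open>Two later losses of at most \<open>2 * \<epsilon> * M\<close> each must leave
    \<open>2 * \<epsilon> * M\<close> out of \<open>\<kappa> * M\<close>.\<close>
  define \<epsilon> where "\<epsilon> = \<kappa> / 6"
  have \<epsilon>: "\<epsilon> > 0" using \<kappa> by (simp add: \<epsilon>_def)
  obtain V where V: "open V" "0 \<in> V" and Vf: "\<And>v x. v \<in> V \<Longrightarrow> \<bar>f (v + x) - f x\<bar> \<le> \<epsilon>"
    using compact_group_uniformly_continuous[OF K f \<epsilon>] by blast
  have Vd: "\<bar>d (v + x) - d x\<bar> \<le> 2 * \<epsilon>" if "v \<in> V" for v x
    using Vf[OF that, of x] Vf[OF that, of "g + x"] unfolding d_def by (simp add: lcomm)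
  obtain S where S: "\<And>x. \<exists>s\<le>S. x - ?g s \<in> V" using generator_syndetic[OF K g V] by blast
  \<comment> \<open>The almost period exceeds \<open>S\<close>, so walking at most \<open>S\<close>
    steps along the orbit costs no more than \<open>2 * \<epsilon> * M\<close>.\<close>
  obtain M where M: "Suc S \<le> M" "?g M \<in> V" by (rule compact_group_recurrent[OF K V])
  have M0: "M > 0" using M by simp
  \<comment> \<open>Each time below \<open>M\<close> lies in some \<open>Q s\<close> with
    \<open>s \<le> N\<close>, so one of these sets has at least \<open>M / Suc N\<close> elements.
    Quotients of powers with exponents in the same \<open>Q s\<close> lie in \<open>W - W\<close>,
    where \<open>d\<close> near \<open>c\<close> is controlled.\<close>
  define Q where "Q s = {n. n < M \<and> ?g n - ?g s \<in> W}" for s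
  have "M \<le> card (\<Union>s\<in>{..N}. Q s)"
  proof -
    have "{..<M} \<subseteq> (\<Union>s\<in>{..N}. Q s)" using N by (auto simp: Q_def)
    moreover have "finite (\<Union>s\<in>{..N}. Q s)" by (auto simp: Q_def)
    ultimately show ?thesis by (metis card_lessThan card_mono)
  qed
  also have "\<dots> \<le> (\<Sum>s\<in>{..N}. card (Q s))" by (rule card_UN_le) simp
  finally have sumQ: "M \<le> (\<Sum>s\<in>{..N}. card (Q s))" .
  have "\<exists>r. M \<le> Suc N * card (Q r)"
  proof (rule ccontr)
    assume "\<nexists>r. M \<le> Suc N * card (Q r)"
    then have "Suc N * card (Q s) < M" for s by (meson not_le)
    then have "(\<Sum>s\<in>{..N}. Suc N * card (Q s)) < (\<Sum>s\<in>{..N}. M)"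
      by (intro sum_strict_mono) auto
    then have "Suc N * (\<Sum>s\<in>{..N}. card (Q s)) < Suc N * M"
      by (simp only: sum_distrib_left[symmetric] sum_constant card_atMost of_nat_id)
    then show False using sumQ by (metis mult_le_mono2 not_le)
  qed
  then obtain r where "M \<le> Suc N * card (Q r)" by blast
  then have r: "real M \<le> real (Suc N) * card (Q r)" by (metis of_nat_le_iff of_nat_mult)
  \<comment> \<open>For \<open>t \<le> s\<close> the index is exactly \<open>s - t\<close>.
    Otherwise it wraps around to \<open>s + M - t\<close>, and the extra factor \<open>?g M\<close>,
    which lies in \<open>V\<close>, changes \<open>d\<close> by at most
    \<open>2 * \<epsilon>\<close>.\<close>
  have coeff: "\<eta> \<le> Re (of_real (\<sigma> * d (?g ((s + M - t) mod M) + c)))" if "s \<in> Q r" "t \<in> Q r" for s t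
  proof -
    have st: "s < M" "t < M" "?g s - ?g r \<in> W" "?g t - ?g r \<in> W" using that by (auto simp: Q_def)
    have eq: "(?g s - ?g r) - (?g t - ?g r) = ?g s - ?g t"
      by (simp only: diff_conv_add_uminus minus_add minus_minus add.assoc minus_add_cancel)
    have big: "\<sigma> * d (?g s - ?g t + c) > 2 * \<eta>" using Wd[OF st(3,4)] unfolding eq .
    show ?thesis
    proof (cases "t \<le> s")
      case True
      then have "?g s = ?g (s - t) + ?g t" by (metis group_power_add le_add_diff_inverse2)
      then have "?g s - ?g t = ?g (s - t)" by simp
      moreover have "(s + M - t) mod M = s - t"
        using True st by (metis Nat.add_diff_assoc2 less_imp_diff_less mod_add_self2 mod_less)
      ultimately show ?thesis using big \<eta> by simp
    next
      case False
      then have "?g M + ?g s = ?g (s + M - t) + ?g t"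
        using st by (simp add: group_power_add[symmetric] add.commute)
      then have "?g (s + M - t) = ?g M + (?g s - ?g t)" by (metis add_diff_cancel add_diff_eq)
      then have "\<bar>d (?g (s + M - t) + c) - d (?g s - ?g t + c)\<bar> \<le> 2 * \<epsilon>"
        using Vd[OF M(2), of "?g s - ?g t + c"] by (simp add: add.assoc)
      then have "\<bar>\<sigma> * d (?g (s + M - t) + c) - \<sigma> * d (?g s - ?g t + c)\<bar> \<le> 2 * \<epsilon>"
        using \<sigma> by (simp add: right_diff_distrib[symmetric] abs_mult)
      then have "\<eta> \<le> \<sigma> * d (?g (s + M - t) + c)"
        using big \<kappa> \<eta> unfolding \<epsilon>_def by linarith
      moreover have "(s + M - t) mod M = s + M - t" using False st by simp
      ultimately show ?thesis by simp
    qed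
  qed
  have "Q r \<subseteq> {..<M}" by (auto simp: Q_def)
  from large_fourier_coefficient[where b = "\<lambda>n. of_real (\<sigma> * d (?g n + c))", OF M0 this coeff] obtain w :: complex
    where w: "norm w = 1" and wM: "w ^ M = 1"
      and big: "\<eta> * card (Q r) \<le> norm (\<Sum>n<M. of_real (\<sigma> * d (?g n + c)) * w ^ n)"
    by blast
  define p where "p x = (\<Sum>n<M. of_real (f (?g n + x)) * w ^ n)" for x
  define q where "q x = (\<Sum>n<M. of_real (d (?g n + x)) * w ^ n)" for x
  have q: "q x = p (g + x) - p x" for x
    by (simp add: p_def q_def d_def sum_subtractf[symmetric] left_diff_distrib lcomm)
  \<comment> \<open>Translation by \<open>g\<close> raises the index by one and the factor
    \<open>w\<close> restores the matching power, so only the end terms remain;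
    \<open>w ^ M = 1\<close> combines them.\<close>
  have telescope: "w * (\<Sum>n<M. of_real (u (?g n + (g + x))) * w ^ n) - (\<Sum>n<M. of_real (u (?g n + x)) * w ^ n)
      = complex_of_real (u (?g M + x) - u x)" for u :: "'g \<Rightarrow> real" and x
  proof -
    have "w * (\<Sum>n<m. of_real (u (?g n + (g + x))) * w ^ n) - (\<Sum>n<m. of_real (u (?g n + x)) * w ^ n)
      = of_real (u (?g m + x)) * w ^ m - of_real (u x)" for m
    proof (induction m)
      case (Suc m)
      have "?g m + (g + x) = ?g (Suc m) + x" by (simp add: ac)
      then show ?case using Suc by (simp add: algebra_simps)
    qed simp
    from this[of M] show ?thesis using wM by simp
  qed
  have p_step: "norm (w * p (g + x) - p x) \<le> \<epsilon>" for x
    unfolding p_def telescope norm_of_real by (rule Vf[OF M(2)])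
  have q_step: "norm (w * q (g + x) - q x) \<le> 2 * \<epsilon>" for x
    unfolding q_def telescope norm_of_real by (rule Vd[OF M(2)])
  have q_c: "norm (q c) \<ge> \<kappa> * M"
  proof -
    have "\<kappa> * M \<le> \<kappa> * (real (Suc N) * card (Q r))" using r \<kappa> by (intro mult_left_mono) auto
    also have "\<dots> = \<eta> * card (Q r)" by (simp add: \<kappa>_def)
    also have "\<dots> \<le> norm (of_real \<sigma> * q c)"
      using big by (simp add: q_def sum_distrib_left mult.assoc)
    also have "\<dots> = norm (q c)" using \<sigma> by (simp add: norm_mult)
    finally show ?thesis .
  qed
  \<comment> \<open>Since \<open>norm w = 1\<close>, each step along \<open>g\<close> lowers the
    modulus of \<open>q\<close> by at most \<open>2 * \<epsilon>\<close>.\<close>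
  have q_orbit: "norm (q (?g s + c)) \<ge> \<kappa> * M - 2 * \<epsilon> * s" for s
  proof (induction s)
    case (Suc s)
    have "norm (q (?g s + c)) - norm (w * q (g + (?g s + c))) \<le> norm (w * q (g + (?g s + c)) - q (?g s + c))"
      by (metis norm_minus_commute norm_triangle_ineq2)
    also have "\<dots> \<le> 2 * \<epsilon>" by (rule q_step)
    finally show ?case using Suc w by (simp add: norm_mult add.assoc algebra_simps)
  qed (use q_c in simp)
  \<comment> \<open>Every \<open>x\<close> differs by an element of \<open>V\<close> from some
    \<open>?g s + c\<close> with \<open>s \<le> S\<close>. Replacing one by the other changes each
    of the \<open>M\<close> terms of \<open>q\<close> by at most
    \<open>2 * \<epsilon>\<close>.\<close>
  have q_large: "norm (q x) > \<epsilon>" for x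
  proof -
    obtain s where s: "s \<le> S" "x - c - ?g s \<in> V" using S by blast
    have x: "x = (x - c - ?g s) + (?g s + c)" by (simp add: add.assoc[symmetric])
    have "norm (q x - q (?g s + c)) = norm (\<Sum>n<M. of_real (d (?g n + x) - d (?g n + (?g s + c))) * w ^ n)"
      by (simp add: q_def sum_subtractf[symmetric] left_diff_distrib)
    also have "\<dots> \<le> (\<Sum>n<M. 2 * \<epsilon>)"
    proof (rule sum_norm_le)
      fix n
      have "?g n + x = (x - c - ?g s) + (?g n + (?g s + c))" by (subst x) (rule lcomm)
      then show "norm (of_real (d (?g n + x) - d (?g n + (?g s + c))) * w ^ n) \<le> 2 * \<epsilon>"
        using Vd[OF s(2), of "?g n + (?g s + c)"] w
        by (simp add: norm_mult norm_power del: of_real_diff)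
    qed
    finally have "norm (q x - q (?g s + c)) \<le> 2 * \<epsilon> * M" by (simp add: mult.commute)
    moreover have "norm (q (?g s + c)) - norm (q x) \<le> norm (q x - q (?g s + c))"
      by (metis norm_minus_commute norm_triangle_ineq2)
    moreover have "2 * \<epsilon> * s \<le> 2 * \<epsilon> * M" using s M \<epsilon> by simp
    ultimately have "norm (q x) \<ge> \<kappa> * M - 4 * \<epsilon> * M" using q_orbit[of s] by simp
    also have "\<kappa> * M - 4 * \<epsilon> * M = 2 * \<epsilon> * M" by (simp add: \<epsilon>_def)
    finally have "norm (q x) \<ge> 2 * \<epsilon> * M" .
    moreover have "2 * \<epsilon> * 1 \<le> 2 * \<epsilon> * M" using \<epsilon> M0 by (intro mult_left_mono) auto
    ultimately show ?thesis using \<epsilon> by linarith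
  qed
  have ratio: "p (g + x) \<noteq> of_real t * p x" if "t \<ge> 0" for x t
  proof
    assume t: "p (g + x) = of_real t * p x"
    \<comment> \<open>As \<open>\<bar>w\<bar> = 1\<close>, a positive ratio \<open>t\<close> is at least as far from \<open>1 / w\<close>, which it nearly equals,
      as from \<open>1\<close>; this would make \<open>q x = (t - 1) p x\<close> small.\<close>
    have "\<bar>t - 1\<bar> = \<bar>norm (w * of_real t) - norm (1::complex)\<bar>" using w that by (simp add: norm_mult)
    also have "\<dots> \<le> norm (w * of_real t - 1)" by (rule norm_triangle_ineq3)
    finally have "\<bar>t - 1\<bar> * norm (p x) \<le> norm (w * of_real t - 1) * norm (p x)"
      by (rule mult_right_mono) simp
    also have "\<dots> = norm (w * p (g + x) - p x)"
      unfolding t norm_mult[symmetric] by (simp add: algebra_simps)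
    also have "\<dots> \<le> \<epsilon>" by (rule p_step)
    finally have "\<bar>t - 1\<bar> * norm (p x) \<le> \<epsilon>" .
    moreover have "q x = of_real (t - 1) * p x" by (simp add: q t algebra_simps)
    then have "norm (q x) = \<bar>t - 1\<bar> * norm (p x)" by (simp only: norm_mult norm_of_real)
    ultimately show False using q_large[of x] by simp
  qed
  have p_nz: "p x \<noteq> 0" for x
  proof
    assume 0: "p x = 0"
    then have "norm (q x) \<le> \<epsilon>" using p_step[of x] w by (simp add: q norm_mult)
    then show False using q_large[of x] by simp
  qed
  show thesis
  proof
    show "continuous_on UNIV p"
      unfolding p_def by (intro continuous_intros continuous_on_compose2[OF f]) auto
    show "p (x + k) = p x" if "\<And>y. f (y + k) = f y" for k x
      using that by (simp add: p_def add.assoc[symmetric])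
  qed (use p_nz ratio in auto)
qed

section \<open>Continuous logarithms\<close>

text \<open>Both functions lift the same map through the covering \<open>exp\<close>. Adding a
  multiple of 2 pi i to \<open>k\<close> makes them agree at \<open>a\<close>, and unique lifting on
  a connected set does the rest.\<close>

lemma complex_log_unique:
  fixes h k :: "'a::real_normed_vector \<Rightarrow> complex"
  assumes S: "connected S" and h: "continuous_on S h" and k: "continuous_on S k"
    and eq: "\<And>x. x \<in> S \<Longrightarrow> exp (h x) = exp (k x)" and a: "a \<in> S" "b \<in> S"
  shows "h b - h a = k b - k a"
proof -
  have ea: "exp (h a - k a) = 1" using eq[OF a(1)] by (simp add: exp_diff)
  have "h b = k b + (h a - k a)"
  proof (rule covering_space_lift_unique[OF covering_space_exp_punctured_plane, where f = "exp \<circ> h" and T = S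
        and ?g1.0 = h and ?g2.0 = "\<lambda>x. k x + (h a - k a)"])
    show "continuous_on S (exp \<circ> h)" by (intro continuous_on_compose continuous_intros h)
    show "continuous_on S (\<lambda>x. k x + (h a - k a))" by (intro continuous_intros k)
    show "(exp \<circ> h) x = exp (k x + (h a - k a))" if "x \<in> S" for x
      using eq[OF that] ea by (simp add: exp_add)
  qed (use S h a in auto)
  then show ?thesis by simp
qed

text \<open>As a circle map the loop contracts in \<open>Y\<close>, so its image under
  \<open>q\<close> is null-homotopic in the punctured plane and has a logarithm on the circle. That
  logarithm has no increment around the circle, and \<open>h\<close> has the same increment by
  uniqueness.\<close>

lemma loop_log_closed:
  fixes q :: "'a::topological_space \<Rightarrow> complex"
  assumes Y: "circle_simply_connected Y" and q: "continuous_on Y q" "\<And>y. y \<in> Y \<Longrightarrow> q y \<noteq> 0"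
    and r: "path r" "path_image r \<subseteq> Y" "pathfinish r = pathstart r"
    and h: "path h" "\<And>t. t \<in> {0..1} \<Longrightarrow> exp (h t) = q (r t)"
  shows "pathfinish h = pathstart h"
proof -
  define c where "c = r \<circ> (\<lambda>z. Arg2pi z / (2 * pi))"
  \<comment> \<open>Continuity of \<open>c\<close> across the cut of \<open>Arg2pi\<close> is read
    off from the constant homotopy of the loop \<open>r\<close>, transferred to circle maps.\<close>
  have "homotopic_with_canon (\<lambda>h. True) (sphere 0 1) Y c c"
    unfolding c_def using r by (intro homotopic_loops_imp_homotopic_circlemaps) (simp add: homotopic_loops_refl)
  from homotopic_with_imp_continuous[OF this] homotopic_with_imp_subset1[OF this]
  have c: "continuous_on (sphere 0 1) c \<and> c ` sphere 0 1 \<subseteq> Y" by simp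
  obtain F :: "complex \<times> real \<Rightarrow> 'a" and x0 where F: "continuous_on (sphere 0 1 \<times> {0..1}) F" "F ` (sphere 0 1 \<times> {0..1}) \<subseteq> Y"
    "\<forall>z \<in> sphere 0 1. F (z, 0) = c z \<and> F (z, 1) = x0"
    using Y[unfolded circle_simply_connected_def, THEN spec, THEN mp, OF c]
    by blast
  have "homotopic_with_canon (\<lambda>h. True) (sphere 0 1) (-{0}) (q \<circ> c) (\<lambda>z. q x0)"
  proof -
    let ?G = "\<lambda>z. q (F (snd z, fst z))"
    have "continuous_on ({0..1} \<times> sphere 0 1) ?G"
      by (intro continuous_on_compose2[OF q(1)] continuous_on_compose2[OF F(1)] continuous_intros)
        (use F(2) in auto)
    moreover have "?G \<in> {0..1} \<times> sphere 0 1 \<rightarrow> -{0}" using F(2) q(2) by fastforce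
    ultimately show ?thesis
      by (simp add: homotopic_with) (intro exI[of _ ?G], use F(3) in auto)
  qed
  then obtain G where G: "continuous_on (sphere 0 1) G" "\<And>z. z \<in> sphere 0 1 \<Longrightarrow> q (c z) = exp (G z)"
    by (metis comp_apply inessential_eq_continuous_logarithm)
  define e where "e t = exp (2 * of_real pi * of_real t * \<i>)" for t :: real
  have e: "e t \<in> sphere 0 1" for t by (simp add: e_def norm_exp_eq_Re)
  have ce: "c (e t) = r t" if "t \<in> {0..1}" for t
  \<comment> \<open>At \<open>t = 1\<close> the argument falls back to 0, and the equation holds
    because \<open>r\<close> is closed.\<close>
  proof (cases "t = 1")
    case True
    then have "e t = 1" by (simp add: e_def)
    then show ?thesis using r True Arg2pi_of_real[of 1] by (simp add: c_def pathstart_def pathfinish_def)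
  next
    case False
    then show ?thesis using that by (simp add: c_def e_def Arg2pi_exp)
  qed
  have "h 1 - h 0 = G (e 1) - G (e 0)"
  proof (rule complex_log_unique[where S = "{0..1::real}"])
    show "continuous_on {0..1} h" using h(1) by (simp add: path_def)
    show "continuous_on {0..1} (\<lambda>t. G (e t))"
      unfolding e_def by (intro continuous_on_compose2[OF G(1)] continuous_intros) (use e e_def in auto)
    show "exp (h t) = exp (G (e t))" if "t \<in> {0..1}" for t
      using h(2)[OF that] G(2)[OF e] ce[OF that] by metis
  qed auto
  moreover have "e 1 = e 0" by (simp add: e_def)
  ultimately show ?thesis by (simp add: pathstart_def pathfinish_def)
qed

text \<open>A logarithm is continued along paths from a base point. Logarithms along loops close up,
  so the end value depends only on the end point; local path connectedness gives continuity.\<close>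

lemma continuous_logarithm_on_circle_simply_connected:
  fixes q :: "'a::topological_space \<Rightarrow> complex"
  assumes Y: "path_connected Y" "locally path_connected Y" "circle_simply_connected Y"
    and q: "continuous_on Y q" "\<And>y. y \<in> Y \<Longrightarrow> q y \<noteq> 0"
  obtains l where "continuous_on Y l" "\<And>y. y \<in> Y \<Longrightarrow> q y = exp (l y)"
proof (cases "Y = {}")
  case False
  then obtain z where z: "z \<in> Y" by blast
  define a where "a = Ln (q z)"
  have a: "exp a = q z" using q(2)[OF z] by (simp add: a_def)
  define lift where "lift r h y \<longleftrightarrow> path r \<and> path_image r \<subseteq> Y \<and> pathstart r = z \<and> pathfinish r = y \<and>
      path h \<and> pathstart h = a \<and> (\<forall>t\<in>{0..1}. exp (h t) = q (r t))" for r and h :: "real \<Rightarrow> complex" and y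
  have lift_exists: "\<exists>r h. lift r h y" if y: "y \<in> Y" for y
  proof -
    obtain r where r: "path r" "path_image r \<subseteq> Y" "pathstart r = z" "pathfinish r = y"
      using Y(1) z y unfolding path_connected_def by blast
    have "continuous_on {0..1} (q \<circ> r)"
      using r q(1) by (metis continuous_on_compose continuous_on_subset path_def path_image_def)
    moreover have "(q \<circ> r) t \<noteq> 0" if "t \<in> {0..1}" for t
      using that r(2) q(2)[of "r t"] by (auto simp: path_image_def image_subset_iff)
    ultimately obtain k where k: "continuous_on {0..1} k" "\<And>t. t \<in> {0..1} \<Longrightarrow> (q \<circ> r) t = exp (k t)"
      using continuous_logarithm_on_contractible[of "{0..1::real}" "q \<circ> r"] convex_imp_contractible
      by (metis convex_real_interval(5))
    have "exp (k 0) = exp a" using k(2)[of 0] r(3) a by (simp add: pathstart_def)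
    then have "exp (k t + (a - k 0)) = exp (k t)" for t by (simp add: exp_add exp_diff)
    moreover have "path (\<lambda>t. k t + (a - k 0))" unfolding path_def by (intro continuous_intros k(1))
    ultimately have "lift r (\<lambda>t. k t + (a - k 0)) y" using r k(2) by (auto simp: lift_def pathstart_def)
    then show ?thesis by blast
  qed
  have lift_unique: "pathfinish h = pathfinish h'" if "lift r h y" "lift r' h' y" for r h r' h' y
  proof -
    have L: "path r" "path_image r \<subseteq> Y" "pathstart r = z" "pathfinish r = y"
      "path h" "pathstart h = a" "\<And>t. t \<in> {0..1} \<Longrightarrow> exp (h t) = q (r t)"
      "path r'" "path_image r' \<subseteq> Y" "pathstart r' = z" "pathfinish r' = y"
      "path h'" "pathstart h' = a" "\<And>t. t \<in> {0..1} \<Longrightarrow> exp (h' t) = q (r' t)"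
      using that by (auto simp: lift_def)
    define d where "d = pathfinish h - pathfinish h'"
    have "exp (pathfinish h) = exp (pathfinish h')"
      using L(7)[of 1] L(14)[of 1] L(4,11) by (simp add: pathfinish_def)
    then have d: "exp d = 1" by (simp add: d_def exp_diff)
    \<comment> \<open>\<open>h'\<close> run backwards and shifted by \<open>d\<close>, a multiple of
      2 pi i, so that it starts where \<open>h\<close> ends. The ends of \<open>h +++ k\<close> then
      differ by exactly \<open>d\<close>, which the loop lemma forces to be 0.\<close>
    define k where "k t = reversepath h' t + d" for t
    have k: "path k" "pathstart k = pathfinish h" "pathfinish k = a + d"
      using L(12,13) by (auto simp: k_def path_def reversepath_def pathstart_def pathfinish_def d_def
          intro!: continuous_intros continuous_on_compose2[of "{0..1}" h'])
    have "pathfinish (h +++ k) = pathstart (h +++ k)"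
    proof (rule loop_log_closed[OF Y(3) q])
      show "path (r +++ reversepath r')" "path_image (r +++ reversepath r') \<subseteq> Y"
        "pathfinish (r +++ reversepath r') = pathstart (r +++ reversepath r')"
        using L by (auto simp: subset_path_image_join)
      show "path (h +++ k)" using L k by simp
      show "exp ((h +++ k) t) = q ((r +++ reversepath r') t)" if "t \<in> {0..1}" for t
        using that L(7)[of "2 * t"] L(14)[of "1 - (2 * t - 1)"] d
        by (auto simp: joinpaths_def k_def reversepath_def exp_add)
    qed
    then show ?thesis using k L by (simp add: d_def)
  qed
  define l where "l y = (THE v. \<exists>r h. lift r h y \<and> v = pathfinish h)" for y
  have l: "l y = pathfinish h" if "lift r h y" for r h y
    unfolding l_def using that lift_unique by blast
  have expl: "q y = exp (l y)" if y: "y \<in> Y" for y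
  proof -
    obtain r h where rh: "lift r h y" using lift_exists[OF y] by blast
    then have "exp (h 1) = q (r 1)" "r 1 = y" by (auto simp: lift_def pathfinish_def)
    then show ?thesis using l[OF rh] by (simp add: pathfinish_def)
  qed
  have local: "\<exists>V. openin (top_of_set Y) V \<and> y \<in> V \<and> continuous_on V l" if y: "y \<in> Y" for y
  proof -
    \<comment> \<open>The unit disc about 1 avoids the cut of \<open>Ln\<close>, so
      \<open>Ln (q u / q y)\<close> supplies a continuous local branch \<open>m\<close>. A path
      connected \<open>V\<close> allows paths ending at \<open>y\<close> to be prolonged inside
      it.\<close>
    have "openin (top_of_set Y) (Y \<inter> (\<lambda>u. q u / q y) -` ball 1 1)"
      using q(1) q(2)[OF y] by (intro continuous_openin_preimage_gen continuous_intros) auto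
    then obtain V where V: "openin (top_of_set Y) V" "path_connected V" "y \<in> V"
      "V \<subseteq> Y \<inter> (\<lambda>u. q u / q y) -` ball 1 1"
      using Y(2) y q(2)[OF y] unfolding locally_path_connected
      by (metis (no_types, lifting) IntI centre_in_ball div_self vimageI2 zero_less_one)
    define m where "m u = l y + Ln (q u / q y)" for u
    have nonpos: "q u / q y \<notin> \<real>\<^sub>\<le>\<^sub>0" if "u \<in> V" for u
    proof
      assume "q u / q y \<in> \<real>\<^sub>\<le>\<^sub>0"
      then obtain x where "q u / q y = of_real x" "x \<le> 0" by (auto elim: nonpos_Reals_cases)
      moreover have "dist 1 (q u / q y) < 1" using V(4) that by auto
      ultimately have "\<bar>1 - x\<bar> < 1" by (metis dist_norm norm_of_real of_real_1 of_real_diff)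
      then show False using \<open>x \<le> 0\<close> by simp
    qed
    have VY: "V \<subseteq> Y" using V(4) by blast
    have m: "continuous_on V m"
      unfolding m_def by (intro continuous_intros continuous_on_subset[OF q(1)] nonpos VY) (use q(2)[OF y] in auto)
    have expm: "exp (m u) = q u" if "u \<in> V" for u
      using that expl[OF y] q(2)[OF y] q(2) VY by (auto simp: m_def exp_add)
    have "l u = m u" if u: "u \<in> V" for u
    proof -
      obtain r h where rh: "lift r h y" using lift_exists[OF y] by blast
      obtain s where s: "path s" "path_image s \<subseteq> V" "pathstart s = y" "pathfinish s = u"
        using V(2,3) u unfolding path_connected_def by blast
      have L: "path r" "path_image r \<subseteq> Y" "pathstart r = z" "pathfinish r = y"
        "path h" "pathstart h = a" "\<And>t. t \<in> {0..1} \<Longrightarrow> exp (h t) = q (r t)"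
        using rh by (auto simp: lift_def)
      have st: "s t \<in> V" if "t \<in> {0..1}" for t using s(2) that by (auto simp: path_image_def)
      have ms: "path (m \<circ> s)" using s m by (simp add: path_continuous_image continuous_on_subset)
      have hm: "pathfinish h = pathstart (m \<circ> s)"
        using l[OF rh] s(3) q(2)[OF y] by (simp add: m_def pathstart_def)
      \<comment> \<open>Following the branch \<open>m\<close> along \<open>s\<close> continues the
        logarithm from \<open>y\<close> to \<open>u\<close>, so path independence identifies
        \<open>l u\<close> with \<open>m u\<close>.\<close>
      have "lift (r +++ s) (h +++ (m \<circ> s)) u"
        unfolding lift_def
      proof (intro conjI ballI)
        show "exp ((h +++ (m \<circ> s)) t) = q ((r +++ s) t)" if "t \<in> {0..1}" for t
          using that L(7)[of "2 * t"] expm[OF st[of "2 * t - 1"]] by (auto simp: joinpaths_def)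
        show "path_image (r +++ s) \<subseteq> Y" using L s VY by (simp add: subset_path_image_join)
      qed (use L s ms hm in auto)
      from l[OF this] show ?thesis using s(4) by (simp add: pathfinish_def joinpaths_def)
    qed
    then have "continuous_on V l" using m by (metis continuous_on_cong)
    then show ?thesis using V by blast
  qed
  have "continuous_on Y l"
    unfolding continuous_on_def
  proof
    fix y assume y: "y \<in> Y"
    obtain V where V: "openin (top_of_set Y) V" "y \<in> V" "continuous_on V l" using local[OF y] by blast
    then obtain U where U: "open U" "V = Y \<inter> U" by (auto simp: openin_open)
    have "at y within V = at y within Y"
      by (rule at_within_nhd[of y U]) (use U V(2) in auto)
    moreover have "(l \<longlongrightarrow> l y) (at y within V)" using V(2,3) by (auto simp: continuous_on_def)
    ultimately show "(l \<longlongrightarrow> l y) (at y within Y)" by simp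
  qed
  then show thesis using that expl by blast
qed (use that in auto)

section \<open>Orbit closures and universal elements\<close>

definition orbit_closure :: "('a::topological_space \<Rightarrow> 'a) \<Rightarrow> 'a \<Rightarrow> 'a set" where
  "orbit_closure S a = closure {(S ^^ n) a |n. True}"

lemma universal_elements_iff: "x \<in> universal_elements S \<longleftrightarrow> orbit_closure S x = UNIV"
  by (simp add: universal_elements_def orbit_closure_def)

lemma closed_orbit_closure: "closed (orbit_closure S a)"
  by (simp add: orbit_closure_def)

lemma funpow_in_orbit_closure: "(S ^^ n) a \<in> orbit_closure S a"
  unfolding orbit_closure_def by (rule closure_subset[THEN subsetD]) blast

lemma self_in_orbit_closure: "a \<in> orbit_closure S a"
  using funpow_in_orbit_closure[of 0 S a] by simp

lemma orbit_closure_subset: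
  assumes "closed C" "\<And>n. (S ^^ n) a \<in> C"
  shows "orbit_closure S a \<subseteq> C"
  unfolding orbit_closure_def by (rule closure_minimal) (use assms in auto)

lemma orbit_closure_invariant:
  fixes S :: "'a::topological_space \<Rightarrow> 'a"
  assumes S: "continuous_on UNIV S" and b: "b \<in> orbit_closure S a"
  shows "S b \<in> orbit_closure S a"
proof -
  have "orbit_closure S a \<subseteq> S -` orbit_closure S a"
  proof (rule orbit_closure_subset)
    show "closed (S -` orbit_closure S a)" by (intro closed_vimage closed_orbit_closure S)
    show "(S ^^ n) a \<in> S -` orbit_closure S a" for n
      using funpow_in_orbit_closure[of "Suc n" S a] by simp
  qed
  then show ?thesis using b by blast
qed

lemma orbit_closure_mono:
  fixes S :: "'a::topological_space \<Rightarrow> 'a"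
  assumes S: "continuous_on UNIV S" and b: "b \<in> orbit_closure S a"
  shows "orbit_closure S b \<subseteq> orbit_closure S a"
proof (rule orbit_closure_subset[OF closed_orbit_closure])
  show "(S ^^ n) b \<in> orbit_closure S a" for n
    by (induction n) (simp_all add: b orbit_closure_invariant[OF S])
qed

lemma closed_fst_image_compact:
  fixes C :: "('a::topological_space \<times> 'b::topological_space) set"
  assumes "compact (UNIV :: 'b set)" "closed C"
  shows "closed (fst ` C)"
proof -
  have "compact_space (euclidean :: 'b topology)" using assms(1) by (simp add: compact_space_def)
  from Abstract_Topological_Spaces.closed_map_fst[OF this, of "euclidean :: 'a topology"]
  have "closed_map (euclidean :: ('a \<times> 'b) topology) (euclidean :: 'a topology) fst"
    by (simp add: euclidean_product_topology)
  then show ?thesis using assms(2) by (simp add: closed_map_def)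
qed

section \<open>Recurrence against drift along universal orbits\<close>

text \<open>If \<open>\<phi>\<close> always increased, the orbit of \<open>y\<close> would stay at
  or above level \<open>\<phi> (T y)\<close> once it has left \<open>y\<close>, and so could not
  return to a neighbourhood of \<open>y\<close> where \<open>\<phi>\<close> is smaller, except at
  \<open>y\<close> itself. This contradicts density.\<close>

lemma no_increasing_function_on_universal:
  fixes T :: "'x::t1_space \<Rightarrow> 'x" and \<phi> :: "'x \<Rightarrow> real"
  assumes Y: "Y \<noteq> {}" "Y \<subseteq> universal_elements T" "T ` Y \<subseteq> Y" "connected Y"
    and \<phi>: "continuous_on Y \<phi>"
  shows "\<exists>u\<in>Y. \<phi> (T u) \<le> \<phi> u"
proof (rule ccontr)
  assume "\<not> (\<exists>u\<in>Y. \<phi> (T u) \<le> \<phi> u)"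
  then have inc: "\<phi> u < \<phi> (T u)" if "u \<in> Y" for u using that by force
  obtain y where y: "y \<in> Y" using Y(1) by blast
  have TY: "(T ^^ n) y \<in> Y" for n using y Y(3) by (induction n) auto
  have ge: "\<phi> (T y) \<le> \<phi> ((T ^^ Suc n) y)" for n
  proof (induction n)
    case (Suc n)
    show ?case using inc[OF TY[of "Suc n"]] Suc by simp
  qed simp
  obtain W where W: "open W" "W \<inter> Y = \<phi> -` {..<\<phi> (T y)} \<inter> Y"
    using \<phi> open_lessThan unfolding continuous_on_open_invariant by blast
  have yW: "y \<in> W" using W(2) inc[OF y] y by blast
  \<comment> \<open>Otherwise \<open>y\<close> would be isolated, and \<open>{y}\<close> and its
    complement would separate \<open>y\<close> from \<open>T y\<close> in the connected set
    \<open>Y\<close>.\<close>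
  have "W - {y} \<noteq> {}"
  proof
    assume "W - {y} = {}"
    then have "W = {y}" using yW by blast
    then have "open {y}" using W(1) by simp
    moreover have "open (- {y})" by (simp add: open_Compl)
    moreover have "T y \<in> Y" using Y(3) y by blast
    moreover have "T y \<noteq> y" using inc[OF y] by auto
    ultimately show False using connectedD[OF Y(4), of "{y}" "- {y}"] y by auto
  qed
  moreover have "open (W - {y})" using W(1) by (simp add: open_Diff)
  moreover have "closure {(T ^^ n) y |n. True} = UNIV"
    using Y(2) y by (auto simp: universal_elements_def)
  ultimately obtain z where "z \<in> W - {y}" "z \<in> {(T ^^ n) y |n. True}"
    using open_Int_closure_eq_empty[of "W - {y}" "{(T ^^ n) y |n. True}"] by auto
  then obtain n where n: "(T ^^ n) y \<in> W" "(T ^^ n) y \<noteq> y" by auto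
  then obtain m where m: "n = Suc m" by (cases n) auto
  have "\<phi> ((T ^^ n) y) < \<phi> (T y)" using n(1) TY[of n] W(2) by blast
  then show False using ge[of m] unfolding m by simp
qed

text \<open>With a logarithm \<open>l\<close> of \<open>q\<close>, the increment \<open>D\<close> of
  \<open>Im l\<close> along \<open>T\<close> can vanish only where the ratio
  \<open>q (T u) / q u\<close> is a positive real. If it never vanishes, it has constant sign on the
  connected set \<open>Y\<close>, and \<open>Im l\<close> up to sign increases along
  \<open>T\<close>.\<close>

lemma no_rotating_function_on_universal:
  fixes T :: "'x::t1_space \<Rightarrow> 'x" and q :: "'x \<Rightarrow> complex"
  assumes T: "continuous_on UNIV T"
    and Y: "Y \<noteq> {}" "Y \<subseteq> universal_elements T" "T ` Y \<subseteq> Y"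
      "path_connected Y" "locally path_connected Y" "circle_simply_connected Y"
    and q: "continuous_on Y q" "\<And>y. y \<in> Y \<Longrightarrow> q y \<noteq> 0"
  shows "\<exists>u\<in>Y. \<exists>t>0. q (T u) = of_real t * q u"
proof (rule ccontr)
  assume no: "\<not> (\<exists>u\<in>Y. \<exists>t>0. q (T u) = of_real t * q u)"
  obtain l where l: "continuous_on Y l" "\<And>y. y \<in> Y \<Longrightarrow> q y = exp (l y)"
    using continuous_logarithm_on_circle_simply_connected[OF Y(4-6) q] by blast
  have TY: "T u \<in> Y" if "u \<in> Y" for u using Y(3) that by blast
  define D where "D u = Im (l (T u)) - Im (l u)" for u
  have D0: "D u \<noteq> 0" if u: "u \<in> Y" for u
  proof
    assume "D u = 0"
    then have "l (T u) = of_real (Re (l (T u)) - Re (l u)) + l u"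
      by (simp add: D_def complex_eq_iff)
    then have "q (T u) = of_real (exp (Re (l (T u)) - Re (l u))) * q u"
      using l(2)[OF u] l(2)[OF TY[OF u]] by (metis exp_add exp_of_real)
    then show False using no u by (metis exp_gt_zero)
  qed
  have D_cont: "continuous_on Y D"
    unfolding D_def
    by (intro continuous_intros continuous_on_compose2[OF l(1)] continuous_on_subset[OF T] l(1))
      (use TY in auto)
  have conn: "connected Y" by (rule path_connected_imp_connected[OF Y(4)])
  obtain y where y: "y \<in> Y" using Y(1) by blast
  define \<sigma> where "\<sigma> = sgn (D y)"
  have pos: "\<sigma> * D u > 0" if u: "u \<in> Y" for u
  proof (rule ccontr)
    assume "\<not> \<sigma> * D u > 0"
    then have "\<sigma> * D u \<le> 0" by simp
    moreover have "0 \<le> \<sigma> * D y" by (simp add: \<sigma>_def sgn_if)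
    moreover have "connected ((\<lambda>u. \<sigma> * D u) ` Y)"
      by (intro connected_continuous_image conn continuous_intros D_cont)
    ultimately have "0 \<in> (\<lambda>u. \<sigma> * D u) ` Y"
      using connectedD_interval[of "(\<lambda>u. \<sigma> * D u) ` Y" "\<sigma> * D u" "\<sigma> * D y" 0] u y by blast
    then obtain v where "v \<in> Y" "\<sigma> * D v = 0" by force
    then show False using D0[of v] D0[OF y] by (simp add: \<sigma>_def sgn_zero_iff)
  qed
  have "continuous_on Y (\<lambda>u. \<sigma> * Im (l u))" by (intro continuous_intros l(1))
  from no_increasing_function_on_universal[OF Y(1-3) conn this]
  obtain u where u: "u \<in> Y" "\<sigma> * Im (l (T u)) \<le> \<sigma> * Im (l u)" by blast
  then show False using pos[OF u(1)] by (simp add: D_def right_diff_distrib)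
qed

section \<open>The skew map and the fibres of its orbit closures\<close>

lemma left_mult_funpow:
  fixes T :: "'a \<Rightarrow> 'a"
  shows "(map_prod T (left_mult g) ^^ n) (x, h) = ((T ^^ n) x, group_power g n + h)"
  by (induction n) (simp_all add: left_mult_def add.assoc)

theorem corollary1p2:
  fixes T :: "'x::t2_space \<Rightarrow> 'x"
    and g :: "'g::{topological_group_add, t2_space}"
    and Y :: "'x set"
  assumes "continuous_on UNIV T"
    and "compact (UNIV :: 'g set)"
    and "is_generator g"
    and "Y \<noteq> {}"
    and "Y \<subseteq> universal_elements T"
    and "T ` Y \<subseteq> Y"
    and "path_connected Y"
    and "locally path_connected Y"
    and "circle_simply_connected Y"
  shows "Y \<times> (UNIV :: 'g set) \<subseteq> universal_elements (map_prod T (left_mult g))"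
proof -
  note T = assms(1) and K = assms(2) and g = assms(3) and Y = assms(4-9)
  note comm = generator_commute[OF g]
  define S where "S = map_prod T (left_mult g)"
  have S: "continuous_on UNIV S"
    unfolding S_def map_prod_def left_mult_def case_prod_unfold
    by (intro continuous_intros continuous_on_compose2[OF T]) auto
  have S_pow: "(S ^^ n) (x, h) = ((T ^^ n) x, group_power g n + h)" for n x h
    unfolding S_def by (rule left_mult_funpow)
  \<comment> \<open>Right translation of the second coordinate commutes with \<open>S\<close>, which
    multiplies on the left.\<close>
  have translate: "(y, h + k) \<in> orbit_closure S (x, h' + k)" if "(y, h) \<in> orbit_closure S (x, h')"
    for x y h h' k
  proof -
    have "orbit_closure S (x, h') \<subseteq> (\<lambda>z. (fst z, snd z + k)) -` orbit_closure S (x, h' + k)"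
    proof (rule orbit_closure_subset)
      show "closed ((\<lambda>z. (fst z, snd z + k)) -` orbit_closure S (x, h' + k))"
        by (intro closed_vimage closed_orbit_closure continuous_intros)
      show "(S ^^ n) (x, h') \<in> (\<lambda>z. (fst z, snd z + k)) -` orbit_closure S (x, h' + k)" for n
        using funpow_in_orbit_closure[of n S "(x, h' + k)"] by (simp add: S_pow add.assoc)
    qed
    then show ?thesis using that by auto
  qed
  have trans: "(z, k) \<in> orbit_closure S a" if "(y, h) \<in> orbit_closure S a" "(z, k) \<in> orbit_closure S (y, h)"
    for y z h k a
    using orbit_closure_mono[OF S that(1)] that(2) by blast
  \<comment> \<open>Projection along the compact factor is closed, so the image of the orbit closure
    contains the whole closure of the \<open>T\<close>-orbit of \<open>x\<close>.\<close>
  have reach: "\<exists>h. (y, h) \<in> orbit_closure S (x, 0)" if "x \<in> universal_elements T" for x y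
  proof -
    have "orbit_closure T x \<subseteq> fst ` orbit_closure S (x, 0)"
    proof (rule orbit_closure_subset)
      show "closed (fst ` orbit_closure S (x, 0))"
        by (intro closed_fst_image_compact K closed_orbit_closure)
      show "(T ^^ n) x \<in> fst ` orbit_closure S (x, 0)" for n
        using funpow_in_orbit_closure[of n S "(x, 0)"] by (force simp: S_pow)
    qed
    then show ?thesis using that by (force simp: universal_elements_iff)
  qed
  have YU: "y \<in> universal_elements T" if "y \<in> Y" for y using Y(2) that by blast
  have full: "orbit_closure S (x, 0) = UNIV" if x: "x \<in> Y" for x
  proof -
    define O' where "O' = orbit_closure S (x, 0)"
    define H where "H = {h. (x, h) \<in> O'}"
    have "closed ((\<lambda>h. (x, h)) -` O')"
      unfolding O'_def by (intro closed_vimage closed_orbit_closure continuous_intros)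
    then have H_closed: "closed H" by (simp add: H_def vimage_def)
    have H0: "0 \<in> H" by (simp add: H_def O'_def self_in_orbit_closure)
    \<comment> \<open>\<open>(y, h + k)\<close> lies in the orbit closure of \<open>(x, k)\<close>,
      which is contained in \<open>O'\<close>. Thus \<open>H\<close> acts on every fibre of
      \<open>O'\<close> from the right.\<close>
    have right: "(y, h + k) \<in> O'" if "(y, h) \<in> O'" "k \<in> H" for y h k
      using trans[of x k "(x, 0)" y "h + k"] translate[of y h x 0 k] that by (simp add: O'_def H_def)
    have H_add: "h + k \<in> H" if "h \<in> H" "k \<in> H" for h k
      using right[of x h k] that by (simp add: H_def)
    have H_minus: "- h \<in> H" if "h \<in> H" for h
      by (rule closed_subsemigroup_uminus[OF K H_closed H0 H_add that])
    have "H = UNIV"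
    proof (rule ccontr)
      assume "H \<noteq> UNIV"
      then obtain w where w: "w \<notin> H" by blast
      have "Hausdorff_space (euclidean :: 'g topology)"
        using hausdorff by (simp add: Hausdorff_space_def disjnt_def) blast
      then have "normal_space (euclidean :: 'g topology)"
        using K by (intro compact_Hausdorff_or_regular_imp_normal_space) (auto simp: compact_space_def)
      then obtain u where u: "continuous_map euclidean (top_of_set {0..1::real}) u"
        "u ` H \<subseteq> {0}" "u ` {w} \<subseteq> {1}"
        using Urysohn_lemma[of "euclidean :: 'g topology" H "{w}" 0 1] H_closed w
        by (auto simp: disjnt_def)
      have u_cont: "continuous_on UNIV u" and u1: "u y \<le> 1" for y
        using u(1) by (auto simp: continuous_map_in_subtopology)
      \<comment> \<open>The supremum over cosets makes the Urysohn function
        \<open>H\<close>-invariant; it is 0 on \<open>H\<close> and at least 1 at \<open>w\<close>,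
        hence not constant.\<close>
      define f where "f y = (SUP h\<in>H. u (y + h))" for y
      have f_cont: "continuous_on UNIV f"
        unfolding f_def using continuous_SUP_translates[OF K u_cont u1] H0 by blast
      have f_inv: "f (y + k) = f y" if k: "k \<in> H" for y k
      proof -
        have "(\<lambda>h. k + h) ` H = H"
        proof
          show "(\<lambda>h. k + h) ` H \<subseteq> H" using H_add k by blast
          show "H \<subseteq> (\<lambda>h. k + h) ` H"
          proof
            fix h assume "h \<in> H"
            then have "- k + h \<in> H" using H_add H_minus k by blast
            then show "h \<in> (\<lambda>h. k + h) ` H" by (rule rev_image_eqI) (simp add: add.assoc[symmetric])
          qed
        qed
        then have "(\<lambda>h. u (y + h)) ` H = (\<lambda>h. u (y + h)) ` (\<lambda>h. k + h) ` H" by simp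
        then show ?thesis by (simp add: f_def image_image add.assoc)
      qed
      have "(\<lambda>h. u (0 + h)) ` H = {0}" using u(2) H0 by auto
      then have f0: "f 0 = 0" by (simp add: f_def)
      have "u (w + 0) \<le> f w"
        unfolding f_def by (rule cSUP_upper[OF H0]) (auto intro!: bdd_aboveI[of _ 1] u1)
      then have f_w: "f 0 \<noteq> f w" using u(3) f0 by simp
      obtain p :: "'g \<Rightarrow> complex" where p_cont: "continuous_on UNIV p" and p_nz: "\<And>y. p y \<noteq> 0"
        and rot: "\<And>y t. t > 0 \<Longrightarrow> p (g + y) \<noteq> of_real t * p y"
        and p_f: "\<And>k y. (\<And>z. f (z + k) = f z) \<Longrightarrow> p (y + k) = p y"
        using generator_rotating_function[OF K g f_cont f_w] by blast
      have p_inv: "p (y + k) = p y" if "k \<in> H" for y k by (intro p_f f_inv that)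
      define q where "q y = p (SOME h. (y, h) \<in> O')" for y
      have q: "q y = p h" if y: "y \<in> Y" and h: "(y, h) \<in> O'" for y h
      proof -
        define h' where "h' = (SOME h. (y, h) \<in> O')"
        have h': "(y, h') \<in> O'" unfolding h'_def by (rule someI[of _ h]) (rule h)
        \<comment> \<open>A return from \<open>y\<close> to \<open>x\<close>: as \<open>y\<close> is
          universal too, some \<open>k\<close> carries the whole fibre of \<open>O'\<close> over
          \<open>y\<close> into \<open>H\<close>. Commutativity then shows that any two points of
          this fibre lie in one coset of \<open>H\<close>, so \<open>q\<close> does not depend on
          the chosen point.\<close>
        obtain k where k: "(x, k) \<in> orbit_closure S (y, 0)" using reach[OF YU[OF y]] by blast
        have kH: "k + j \<in> H" if "(y, j) \<in> O'" for j
          using trans[of y j "(x, 0)" x "k + j"] translate[OF k, of j] that by (simp add: H_def O'_def)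
        have "p h' = p (h' + (k + h))" using p_inv[OF kH[OF h]] by simp
        also have "h' + (k + h) = h + (k + h')" using comm by (metis add.assoc)
        also have "p (h + (k + h')) = p h" by (rule p_inv[OF kH[OF h']])
        finally show ?thesis by (simp add: q_def h'_def)
      qed
      have O_reach: "\<exists>h. (y, h) \<in> O'" for y using reach[OF YU[OF x]] by (simp add: O'_def)
      \<comment> \<open>The preimage of a closed set under \<open>q\<close> is the trace on
        \<open>Y\<close> of a projection of a closed subset of \<open>O'\<close>, and projection
        along the compact group is closed.\<close>
      have q_cont: "continuous_on Y q"
        unfolding continuous_on_closed_invariant
      proof (intro allI impI)
        fix B :: "complex set" assume B: "closed B"
        let ?A = "fst ` (O' \<inter> (\<lambda>z. p (snd z)) -` B)"
        have "closed ?A"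
          unfolding O'_def
          by (intro closed_fst_image_compact K closed_Int closed_orbit_closure closed_vimage B
              continuous_on_compose2[OF p_cont] continuous_intros) auto
        moreover have "?A \<inter> Y = q -` B \<inter> Y"
        proof
          show "?A \<inter> Y \<subseteq> q -` B \<inter> Y" using q by auto
          show "q -` B \<inter> Y \<subseteq> ?A \<inter> Y"
          proof
            fix y assume y: "y \<in> q -` B \<inter> Y"
            obtain h where h: "(y, h) \<in> O'" using O_reach by blast
            then have "(y, h) \<in> O' \<inter> (\<lambda>z. p (snd z)) -` B" using y q[OF _ h] by auto
            then have "fst (y, h) \<in> ?A" by (rule imageI)
            then show "y \<in> ?A \<inter> Y" using y by simp
          qed
        qed
        ultimately show "\<exists>A. closed A \<and> A \<inter> Y = q -` B \<inter> Y" by blast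
      qed
      have q_nz: "q y \<noteq> 0" for y by (simp add: q_def p_nz)
      obtain v t where v: "v \<in> Y" "t > 0" "q (T v) = of_real t * q v"
        using no_rotating_function_on_universal[OF T Y q_cont q_nz] by blast
      obtain h where h: "(v, h) \<in> O'" using O_reach by blast
      \<comment> \<open>Applying \<open>S\<close> to a point over \<open>v\<close> expresses
        \<open>q (T v)\<close> as \<open>p (g + h)\<close>, while \<open>q v\<close> is
        \<open>p h\<close>; the positive ratio found for \<open>q\<close> is one that
        \<open>p\<close> excludes.\<close>
      have "(T v, g + h) \<in> O'"
        using orbit_closure_invariant[OF S, of "(v, h)" "(x, 0)"] h
        by (simp add: O'_def S_def left_mult_def)
      moreover have "T v \<in> Y" using Y(3) v(1) by blast
      ultimately have "q (T v) = p (g + h)" by (intro q)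
      then show False using rot[OF v(2), of h] v(3) q[OF v(1) h] by simp
    qed
    \<comment> \<open>Every fibre is nonempty and, with \<open>H\<close> the whole group, invariant
      under all right translations.\<close>
    have "(y, h) \<in> O'" for y h
    proof -
      obtain k where k: "(y, k) \<in> O'" using reach[OF YU[OF x]] by (auto simp: O'_def)
      show ?thesis using right[OF k, of "- k + h"] \<open>H = UNIV\<close> by simp
    qed
    then show ?thesis by (auto simp: O'_def)
  qed
  have "orbit_closure S (x, h) = UNIV" if "x \<in> Y" for x h
  proof -
    have "(y, k) \<in> orbit_closure S (x, h)" for y k
      using translate[of y "k - h" x 0 h] full[OF that] by simp
    then show ?thesis by auto
  qed
  then show ?thesis by (auto simp: universal_elements_iff S_def)
qed

end
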